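(* Let $A,B\subset \mathbb{R}^n$ and let $x\in \mathbb{R}^n$. Then \[ \mathrm{Tan}_x(A\cup B)=\mathrm{Tan}_x(A)\cup \mathrm{Tan}_x(B), \] and therefore \[ \mathrm{span}\bigl(\mathrm{Tan}_x(A\cup B)\bigr)=\mathrm{span}(\mathrm{Tan}_x(A))+\mathrm{span}(\mathrm{Tan}_x(B)). \] Consequently, \[ \dim_{\mathrm{Ptan}}\{x\}_{A\cup B}=\dim_{\mathrm{Ptan}}\{x\}_{A}+\dim_{\mathrm{Ptan}}\{x\}_{B}-\dim\bigl(\mathrm{span}(\mathrm{Tan}_x(A))\cap \mathrm{span}(\mathrm{Tan}_x(B))\bigr). \] In particular, \[ \max\bigl\{\dim_{\mathrm{Ptan}}\{x\}_{A},\dim_{\mathrm{Ptan}}\{x\}_{B}\bigr\}\le \dim_{\mathrm{Ptan}}\{x\}_{A\cup B}\le \min\bigl\{n,\ \dim_{\mathrm{Ptan}}\{x\}_{A}+\dim_{\mathrm{Ptan}}\{x\}_{B}\bigr\}. \]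
   Context: For $A\subset\mathbb{R}^n$ and $x\in\mathbb{R}^n$, the Bouligand tangent cone $\mathrm{Tan}_x(A)$ is the set of $v\in\mathbb{R}^n$ for which there exist $x_k\in A$ with $x_k\to x$ and positive reals $\lambda_k\downarrow 0$ such that $(x_k-x)/\lambda_k\to v$. (If $x\notin\overline A$ then $\mathrm{Tan}_x(A)=\varnothing$.) The point-tangential dimension of $A$ at $x$ is $\dim_{\mathrm{Ptan}}\{x\}_A:=\dim\mathrm{span}(\mathrm{Tan}_x(A))$, with the convention $\mathrm{span}(\varnothing)=\{0\}$. *)

theory Defs
  imports "HOL-Analysis.Analysis" "HOL-Library.Set_Algebras"
begin

text \<open>The condition \<open>\<lambda>\<^sub>k \<down> 0\<close> is read as: nonincreasing with limit 0.\<close>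

definition bouligand_tangent_cone :: "'a::real_normed_vector \<Rightarrow> 'a set \<Rightarrow> 'a set" where
  "bouligand_tangent_cone x A =
     {v. \<exists>(X :: nat \<Rightarrow> 'a) (l :: nat \<Rightarrow> real).
           (\<forall>k. X k \<in> A) \<and> X \<longlonglongrightarrow> x \<and>
           (\<forall>k. l k > 0) \<and> decseq l \<and> l \<longlonglongrightarrow> 0 \<and>
           (\<lambda>k. (X k - x) /\<^sub>R l k) \<longlonglongrightarrow> v}"

text \<open>The convention for the span of the empty set agrees with the library: \<open>span {} = {0}\<close>.\<close>

definition ptan_dim :: "'a::euclidean_space \<Rightarrow> 'a set \<Rightarrow> nat" where
  "ptan_dim x A = dim (span (bouligand_tangent_cone x A))"

end

theory Submission
  imports Defs
begin

text \<open>A sequence in \<open>A \<union> B\<close> has a subsequence lying entirely in \<open>A\<close> or entirely in \<open>B\<close>, and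
  passing to a subsequence keeps all limits in the definition of the tangent cone. The rest is the
  dimension formula for sums of subspaces.\<close>

lemma bouligand_tangent_cone_mono:
  "A \<subseteq> B \<Longrightarrow> bouligand_tangent_cone x A \<subseteq> bouligand_tangent_cone x B"
  unfolding bouligand_tangent_cone_def by blast

text \<open>Only infinitely many terms of \<open>X\<close> are required to lie in \<open>A\<close>:
  enumerating their indices increasingly gives \<open>r\<close>, and \<open>X \<circ> r\<close>
  together with \<open>l \<circ> r\<close> witnesses the membership of \<open>v\<close>.\<close>

lemma bouligand_tangent_cone_frequently_in:
  fixes X :: "nat \<Rightarrow> 'a::real_normed_vector"
  assumes inf: "infinite {k. X k \<in> A}"
    and X: "X \<longlonglongrightarrow> x"
    and l: "\<And>k. l k > 0" "decseq l" "l \<longlonglongrightarrow> 0"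
    and v: "(\<lambda>k. (X k - x) /\<^sub>R l k) \<longlonglongrightarrow> v"
  shows "v \<in> bouligand_tangent_cone x A"
proof -
  obtain r :: "nat \<Rightarrow> nat" where r: "strict_mono r" and rA: "\<And>n. X (r n) \<in> A"
    using infinite_enumerate[OF inf] by blast
  \<comment> \<open>The one clause that is neither pointwise nor a limit; it survives because
    \<open>r\<close> is increasing.\<close>
  have "decseq (l \<circ> r)"
    using l(2) r by (simp add: decseq_def strict_mono_less_eq)
  moreover have "(X \<circ> r) \<longlonglongrightarrow> x" "(l \<circ> r) \<longlonglongrightarrow> 0"
    "(\<lambda>k. ((X \<circ> r) k - x) /\<^sub>R (l \<circ> r) k) \<longlonglongrightarrow> v"
    using LIMSEQ_subseq_LIMSEQ[OF X r] LIMSEQ_subseq_LIMSEQ[OF l(3) r]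
      LIMSEQ_subseq_LIMSEQ[OF v r] by (simp_all add: o_def)
  moreover have "\<forall>k. (X \<circ> r) k \<in> A" "\<forall>k. (l \<circ> r) k > 0"
    using rA l(1) by simp_all
  ultimately show ?thesis
    unfolding bouligand_tangent_cone_def by blast
qed

lemma bouligand_tangent_cone_Un:
  "bouligand_tangent_cone x (A \<union> B) = bouligand_tangent_cone x A \<union> bouligand_tangent_cone x B"
proof
  show "bouligand_tangent_cone x (A \<union> B) \<subseteq> bouligand_tangent_cone x A \<union> bouligand_tangent_cone x B"
  proof
    fix v assume "v \<in> bouligand_tangent_cone x (A \<union> B)"
    then obtain X l where XAB: "\<And>k. X k \<in> A \<union> B"
      and lim: "X \<longlonglongrightarrow> x" "\<And>k. l k > 0" "decseq l" "l \<longlonglongrightarrow> 0"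
        "(\<lambda>k. (X k - x) /\<^sub>R l k) \<longlonglongrightarrow> v"
      unfolding bouligand_tangent_cone_def by blast
    have "{k. X k \<in> A} \<union> {k. X k \<in> B} = UNIV"
      using XAB by blast
    \<comment> \<open>Pigeonhole: two finite index sets cannot cover all of
      \<open>nat\<close>.\<close>
    then have "infinite {k. X k \<in> A} \<or> infinite {k. X k \<in> B}"
      by (metis finite_Un infinite_UNIV_nat)
    then show "v \<in> bouligand_tangent_cone x A \<union> bouligand_tangent_cone x B"
      using bouligand_tangent_cone_frequently_in[OF _ lim] by blast
  qed
\<comment> \<open>The reverse inclusion is monotonicity applied to each half of the union.\<close>
qed (simp add: bouligand_tangent_cone_mono)

lemma span_Un_eq_plus: "span (S \<union> T) = span S + span T"
  by (auto simp: span_Un set_plus_def)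

text \<open>Grassmann's formula, with the sum of subspaces written as set addition. The additive
  form avoids truncated subtraction on \<open>nat\<close>.\<close>

lemma dim_plus_Int:
  fixes S T :: "'a::euclidean_space set"
  assumes "subspace S" "subspace T"
  shows "dim (S + T) + dim (S \<inter> T) = dim S + dim T"
proof -
  have "S + T = {x + y |x y. x \<in> S \<and> y \<in> T}"
    by (auto simp: set_plus_def)
  then show ?thesis
    using dim_sums_Int[OF assms] by simp
qed

lemma ptan_dim_mono: "A \<subseteq> B \<Longrightarrow> ptan_dim x A \<le> ptan_dim x B"
  unfolding ptan_dim_def by (intro dim_subset span_mono bouligand_tangent_cone_mono)

theorem proposition2p41:
  fixes A B :: "(real ^ 'n) set" and x :: "real ^ 'n"
  shows "bouligand_tangent_cone x (A \<union> B) =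
           bouligand_tangent_cone x A \<union> bouligand_tangent_cone x B
       \<and> span (bouligand_tangent_cone x (A \<union> B)) =
           span (bouligand_tangent_cone x A) + span (bouligand_tangent_cone x B)
       \<and> int (ptan_dim x (A \<union> B)) =
           int (ptan_dim x A) + int (ptan_dim x B)
           - int (dim (span (bouligand_tangent_cone x A) \<inter> span (bouligand_tangent_cone x B)))
       \<and> max (ptan_dim x A) (ptan_dim x B) \<le> ptan_dim x (A \<union> B)
       \<and> ptan_dim x (A \<union> B) \<le> min CARD('n) (ptan_dim x A + ptan_dim x B)"
proof -
  have span: "span (bouligand_tangent_cone x (A \<union> B)) =
      span (bouligand_tangent_cone x A) + span (bouligand_tangent_cone x B)"
    by (simp add: bouligand_tangent_cone_Un span_Un_eq_plus)
  \<comment> \<open>This equation on \<open>nat\<close> yields two conclusions: moving the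
    intersection term across gives the formula over \<open>int\<close>, and discarding it gives the
    upper bound by the sum of the dimensions.\<close>
  have dim: "ptan_dim x (A \<union> B)
      + dim (span (bouligand_tangent_cone x A) \<inter> span (bouligand_tangent_cone x B))
      = ptan_dim x A + ptan_dim x B"
    unfolding ptan_dim_def span by (rule dim_plus_Int) simp_all
  have "ptan_dim x (A \<union> B) \<le> CARD('n)"
    unfolding ptan_dim_def by (rule dim_subset_UNIV_cart)
  \<comment> \<open>The lower bound comes from \<open>A\<close> and \<open>B\<close> being subsets
    of the union, independently of the dimension formula.\<close>
  moreover have "max (ptan_dim x A) (ptan_dim x B) \<le> ptan_dim x (A \<union> B)"
    by (simp add: ptan_dim_mono)
  ultimately show ?thesis
    using bouligand_tangent_cone_Un[of x A B] span dim by simp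
qed

end
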